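(* Let $n\ge2$, $p\ge1$, let $y_{ij}\in\{0,1\}$ for $i=1,\dots,n$, $j=1,\dots,p$, and $\bar y_j=\frac1n\sum_{i=1}^n y_{ij}$. With $\sigma_\beta=1$ (i.e. prior $\beta_j\sim\mathrm{N}(0,\sigma_\beta^2)$, $\sigma_\beta=1$, for all $j=1,\dots,p$), the EM updates $$(\zeta_j^{t+1})^2=\frac{1}{\sigma_\beta^{-2}-2n\,A(\zeta_j^t)}+\frac{n^2(\bar y_j-1/2)^2}{\{\sigma_\beta^{-2}-2n\,A(\zeta_j^t)\}^2}\qquad(j=1,\dots,p)$$ are globally asymptotically stable. Moreover, writing $\lambda_j^t:=(\zeta_j^t)^2$ and $\lambda_j^*$ for the corresponding fixed point ($j=1,\dots,p$), there exists a global constant $\rho\in(0,1)$ (not depending on the initialization, on $t$ or on $j$) such that $$|\lambda_j^t-\lambda_j^*|\le\rho^t\,|\lambda_j^0-\lambda_j^*|$$ for all $t$, all $j=1,\dots,p$ and any initialization.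
   Context: $A(t)=-\tanh(t/2)/(4t)$, with $A(0)=-1/8$. The updates are the EM (tangent transform) updates for the model $\Pr(y_{ij}=1\mid\beta)=1/\{1+\exp(-\beta_j)\}$ with independent Gaussian priors on the $\beta_j$. Each coordinate is viewed as a discrete-time autonomous dynamical system in the variable $\lambda_j=\zeta_j^2>0$. A fixed point $\lambda^*$ of a system $\lambda^{t+1}=f(\lambda^t)$ is (locally) asymptotically stable if for every $\epsilon>0$ there is $\delta>0$ such that $|\lambda^0-\lambda^*|<\delta$ implies $|f(\lambda^t)-\lambda^*|<\epsilon$ for all $t$, and $\lambda^t\to\lambda^*$ for initializations near $\lambda^*$; it is globally asymptotically stable if convergence to $\lambda^*$ holds for every initialization in the domain. *)

theory Defs
  imports Complex_Main
begin

definition tt_A :: "real \<Rightarrow> real" where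
  "tt_A t = (if t = 0 then - 1 / 8 else - tanh (t / 2) / (4 * t))"

definition col_mean :: "nat \<Rightarrow> (nat \<Rightarrow> nat \<Rightarrow> real) \<Rightarrow> nat \<Rightarrow> real" where
  "col_mean n y j = (1 / real n) * (\<Sum>i = 1..n. y i j)"

text \<open>
  The EM update of one coordinate gives the new squared variational parameter as a
  function of the current parameter \<open>\<zeta>\<close>; \<open>s\<close> is the prior standard deviation and \<open>m\<close> the
  sample mean.
\<close>

definition em_update :: "real \<Rightarrow> nat \<Rightarrow> real \<Rightarrow> real \<Rightarrow> real" where
  "em_update s n m \<zeta> =
     1 / (1 / s\<^sup>2 - 2 * real n * tt_A \<zeta>)
     + (real n)\<^sup>2 * (m - 1 / 2)\<^sup>2 / (1 / s\<^sup>2 - 2 * real n * tt_A \<zeta>)\<^sup>2"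

text \<open>
  The same update as a self-map in the variable \<open>l = \<zeta>\<^sup>2 > 0\<close>. Since \<^const>\<open>tt_A\<close> is even, the
  choice of square root is immaterial.
\<close>

definition em_map :: "real \<Rightarrow> nat \<Rightarrow> real \<Rightarrow> real \<Rightarrow> real" where
  "em_map s n m l = em_update s n m (sqrt l)"

text \<open>
  \<open>\<zeta> t j\<close> is coordinate \<open>j \<in> {1..p}\<close> at time \<open>t\<close>. The update determines only the square of
  \<open>\<zeta> (Suc t) j\<close>, so either sign is allowed. The condition \<open>\<zeta> 0 j \<noteq> 0\<close> says that the
  initialization lies in the domain \<open>l > 0\<close>.
\<close>

definition em_trajectory ::
  "real \<Rightarrow> nat \<Rightarrow> nat \<Rightarrow> (nat \<Rightarrow> nat \<Rightarrow> real) \<Rightarrow> (nat \<Rightarrow> nat \<Rightarrow> real) \<Rightarrow> bool" where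
  "em_trajectory s n p y \<zeta> \<longleftrightarrow>
     (\<forall>j\<in>{1..p}. \<zeta> 0 j \<noteq> 0 \<and>
        (\<forall>t. (\<zeta> (Suc t) j)\<^sup>2 = em_update s n (col_mean n y j) (\<zeta> t j)))"

text \<open>
  Stability notions for the system \<open>x\<^sub>t\<^sub>+\<^sub>1 = f x\<^sub>t\<close> on a domain \<open>D\<close>; the state at time \<open>t\<close>
  started from \<open>x\<close> is \<open>(f ^^ t) x\<close>.
\<close>

definition asymptotically_stable :: "real set \<Rightarrow> (real \<Rightarrow> real) \<Rightarrow> real \<Rightarrow> bool" where
  "asymptotically_stable D f a \<longleftrightarrow>
     a \<in> D \<and> f a = a \<and>
     (\<forall>\<epsilon>>0. \<exists>\<delta>>0. \<forall>x\<in>D. \<bar>x - a\<bar> < \<delta> \<longrightarrow> (\<forall>t. \<bar>f ((f ^^ t) x) - a\<bar> < \<epsilon>)) \<and>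
     (\<exists>\<delta>>0. \<forall>x\<in>D. \<bar>x - a\<bar> < \<delta> \<longrightarrow> (\<lambda>t. (f ^^ t) x) \<longlonglongrightarrow> a)"

definition globally_asymptotically_stable :: "real set \<Rightarrow> (real \<Rightarrow> real) \<Rightarrow> real \<Rightarrow> bool" where
  "globally_asymptotically_stable D f a \<longleftrightarrow>
     asymptotically_stable D f a \<and> (\<forall>x\<in>D. (\<lambda>t. (f ^^ t) x) \<longlonglongrightarrow> a)"

end

theory Submission
  imports Defs
begin

text \<open>
  Write \<open>s = \<surd>l\<close>, \<open>T = tanh (s / 2)\<close>, \<open>D = 2 s + n T\<close> and \<open>K = T - s (1 - T\<^sup>2) / 2\<close>. The derivative
  of the update with respect to \<open>l\<close> is nonnegative, and it is largest when the sample mean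
  is \<open>0\<close> or \<open>1\<close>, where it equals \<open>n K (D + s n\<^sup>2) / (s D\<^sup>3)\<close>. The inequalities \<open>2 T \<le> s\<close> and
  \<open>0 \<le> K \<le> T\<^sup>3\<close> bound this by \<open>n / (n + 1)\<close> for all \<open>l > 0\<close>, so the update is a contraction.
  As the update takes values in a compact subinterval of the positive reals, it has a fixed point there.
\<close>

section \<open>Inequalities for tanh and the polynomial estimate\<close>

lemma tanh_le_self:
  fixes x :: real
  assumes "0 \<le> x"
  shows "tanh x \<le> x"
proof -
  have "0 - tanh 0 \<le> x - tanh x"
  proof (rule DERIV_nonneg_imp_nondecreasing[OF assms])
    fix z :: real
    have "((\<lambda>x. x - tanh x) has_real_derivative (tanh z)\<^sup>2) (at z)"
      by (auto intro!: derivative_eq_intros)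
    then show "\<exists>d. ((\<lambda>x. x - tanh x) has_real_derivative d) (at z) \<and> 0 \<le> d"
      using zero_le_power2 by blast
  qed
  then show ?thesis by simp
qed

text \<open>At \<open>x = s / 2\<close> this is \<open>0 \<le> K\<close>. The difference of the two
  sides vanishes at 0 and has derivative \<open>2 * x * tanh x * (1 - (tanh x)\<^sup>2)\<close>,
  which is nonnegative for \<open>x \<ge> 0\<close>.\<close>

lemma self_mult_tanh_deriv_le:
  fixes x :: real
  assumes "0 \<le> x"
  shows "x * (1 - (tanh x)\<^sup>2) \<le> tanh x"
proof -
  have "tanh 0 - 0 * (1 - (tanh 0)\<^sup>2) \<le> tanh x - x * (1 - (tanh x)\<^sup>2)"
  proof (rule DERIV_nonneg_imp_nondecreasing[OF assms])
    fix z :: real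
    assume "0 \<le> z"
    have "((\<lambda>x. tanh x - x * (1 - (tanh x)\<^sup>2)) has_real_derivative
        2 * z * tanh z * (1 - (tanh z)\<^sup>2)) (at z)"
      by (auto intro!: derivative_eq_intros simp: algebra_simps power2_eq_square)
    moreover have "(tanh z)\<^sup>2 \<le> 1"
      using tanh_real_bounds[of z] by (auto simp: abs_square_le_1 abs_le_iff)
    ultimately show "\<exists>d. ((\<lambda>x. tanh x - x * (1 - (tanh x)\<^sup>2)) has_real_derivative d) (at z) \<and> 0 \<le> d"
      using \<open>0 \<le> z\<close> by (intro exI[of _ "2 * z * tanh z * (1 - (tanh z)\<^sup>2)"]) simp
  qed
  then show ?thesis by simp
qed

text \<open>This is the bound \<open>N / (N + 1)\<close> on the derivative with denominators
  cleared. Once \<open>K\<close> is replaced by \<open>T ^ 3\<close>, the term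
  \<open>s * (N * T) ^ 3\<close> occurs on both sides; \<open>T \<le> s\<close> and
  \<open>N + 1 \<le> 2 * N\<close> absorb the rest into the two mixed terms of the expanded
  cube.\<close>

lemma contraction_bound:
  fixes N s T K :: real
  assumes "1 \<le> N" "0 < s" "0 < T" "2 * T \<le> s" "K \<le> T ^ 3"
  shows "(N + 1) * (K * (2 * s + N * T + s * N\<^sup>2)) \<le> s * (2 * s + N * T) ^ 3"
proof -
  have "(N + 1) * (K * (2 * s + N * T + s * N\<^sup>2))
      \<le> (N + 1) * (T ^ 3 * (2 * s + N * T + s * N\<^sup>2))"
    using assms by (intro mult_left_mono mult_right_mono) auto
  also have "\<dots> = s * (N * T) ^ 3 + N\<^sup>2 * (T ^ 3 * s) + (N + 1) * (2 * (T ^ 3 * s)) + (N + 1) * (N * T ^ 4)"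
    by algebra
  also have "\<dots> \<le> s * (N * T) ^ 3 + N\<^sup>2 * (T\<^sup>2 * s\<^sup>2) + (2 * N) * (2 * (T * s ^ 3)) + (2 * N) * (N * (T\<^sup>2 * s\<^sup>2))"
  proof -
    have "T \<le> s" using assms by simp
    then have "T\<^sup>2 \<le> s\<^sup>2" using assms by (intro power_mono) auto
    have "T ^ 3 * s = T\<^sup>2 * s * T" "T\<^sup>2 * s\<^sup>2 = T\<^sup>2 * s * s"
      by algebra+
    then have "T ^ 3 * s \<le> T\<^sup>2 * s\<^sup>2"
      using \<open>T \<le> s\<close> assms by (simp add: mult_left_mono)
    moreover have "T ^ 3 * s = T * s * T\<^sup>2" "T * s ^ 3 = T * s * s\<^sup>2"
      by algebra+
    then have "T ^ 3 * s \<le> T * s ^ 3"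
      using \<open>T\<^sup>2 \<le> s\<^sup>2\<close> assms by (simp add: mult_left_mono)
    moreover have "T\<^sup>2 * T\<^sup>2 \<le> T\<^sup>2 * s\<^sup>2"
      using \<open>T\<^sup>2 \<le> s\<^sup>2\<close> by (intro mult_left_mono) auto
    then have "T ^ 4 \<le> T\<^sup>2 * s\<^sup>2"
      by (simp flip: power_add)
    ultimately show ?thesis
      using assms
      by (intro add_mono order_refl mult_mono[of "N + 1" "2 * N"] mult_left_mono) auto
  qed
  also have "\<dots> \<le> s * (N * T) ^ 3 + 6 * (N * T * s)\<^sup>2 + 12 * (N * T * s ^ 3) + 8 * s ^ 4"
    using assms by (simp add: power_mult_distrib power2_eq_square[of N])
  also have "\<dots> = s * (2 * s + N * T) ^ 3"
    by algebra
  finally show ?thesis .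
qed

section \<open>The update as a function of the squared parameter\<close>

lemma tt_A_minus [simp]: "tt_A (- x) = tt_A x"
  by (simp add: tt_A_def)

text \<open>The common denominator of the update for unit prior variance, at \<open>l > 0\<close>.
  At \<open>l = 0\<close> division by zero gives 1 here, whereas the update has
  \<open>1 + n / 4\<close>.\<close>

definition em_rate :: "nat \<Rightarrow> real \<Rightarrow> real" where
  "em_rate n l = 1 + real n * (tanh (sqrt l / 2) / (2 * sqrt l))"

lemma em_map_eq:
  assumes "0 < l"
  shows "em_map 1 n m l = 1 / em_rate n l + (real n)\<^sup>2 * (m - 1 / 2)\<^sup>2 / (em_rate n l)\<^sup>2"
  using assms by (simp add: em_map_def em_update_def em_rate_def tt_A_def)

text \<open>The square root of \<open>z\<^sup>2\<close> is \<open>\<bar>z\<bar>\<close>, and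
  \<open>tt_A\<close> is even, so the sign of \<open>z\<close> is lost harmlessly.\<close>

lemma em_update_eq_em_map: "em_update s n m z = em_map s n m (z\<^sup>2)"
  by (simp add: em_map_def em_update_def abs_if)

lemma em_rate_bounds:
  assumes "0 < l"
  shows "1 \<le> em_rate n l" "em_rate n l \<le> 1 + real n / 4"
proof -
  have "tanh (sqrt l / 2) / (2 * sqrt l) \<le> 1 / 4"
    using assms tanh_le_self[of "sqrt l / 2"] by (simp add: field_simps)
  from mult_left_mono[OF this, of "real n"] show "em_rate n l \<le> 1 + real n / 4"
    by (simp add: em_rate_def)
  show "1 \<le> em_rate n l"
    using assms by (simp add: em_rate_def)
qed

text \<open>The bracket in the numerator is \<open>K\<close>; as \<open>K\<close> is nonnegative,
  the rate is nonincreasing in \<open>l\<close>.\<close>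

lemma em_rate_deriv:
  assumes "0 < l"
  defines "T \<equiv> tanh (sqrt l / 2)"
  shows "(em_rate n has_real_derivative
           - real n * (T - sqrt l / 2 * (1 - T\<^sup>2)) / (4 * sqrt l ^ 3)) (at l)"
proof -
  define s where "s = sqrt l"
  have s: "0 < s" using assms(1) by (simp add: s_def)
  have "(sqrt has_real_derivative 1 / (2 * s)) (at l)"
    using DERIV_real_sqrt[OF assms(1)] by (simp add: s_def field_simps)
  \<comment> \<open>Chain rule with inner function \<open>sqrt\<close>, its derivative expressed
    through \<open>s\<close>.\<close>
  note [derivative_intros] = DERIV_chain2[OF _ this]
  have "((\<lambda>l. tanh (sqrt l / 2)) has_real_derivative (1 - T\<^sup>2) / (4 * s)) (at l)"
    unfolding T_def by (rule derivative_eq_intros refl | simp)+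
  moreover have "((\<lambda>l. 2 * sqrt l) has_real_derivative 1 / s) (at l)"
    by (rule derivative_eq_intros refl | simp)+
  ultimately have "((\<lambda>l. tanh (sqrt l / 2) / (2 * sqrt l)) has_real_derivative
      ((1 - T\<^sup>2) / (4 * s) * (2 * s) - T * (1 / s)) / (2 * s * (2 * s))) (at l)"
    using DERIV_divide s unfolding T_def s_def by fastforce
  from DERIV_add[OF DERIV_const[of 1] DERIV_cmult[OF this, of "real n"]]
  have "(em_rate n has_real_derivative
      real n * (((1 - T\<^sup>2) / (4 * s) * (2 * s) - T * (1 / s)) / (2 * s * (2 * s)))) (at l)"
    by (simp add: em_rate_def[abs_def])
  also have "real n * (((1 - T\<^sup>2) / (4 * s) * (2 * s) - T * (1 / s)) / (2 * s * (2 * s)))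
      = - real n * (T - s / 2 * (1 - T\<^sup>2)) / (4 * s ^ 3)"
    using s by (simp add: field_simps power3_eq_cube)
  finally show ?thesis by (simp add: s_def)
qed

text \<open>The map is \<open>1 / b + N\<^sup>2 * c / b\<^sup>2\<close> evaluated at
  \<open>b = em_rate n l\<close>. Outer and inner derivatives are both nonpositive, so their product
  \<open>d\<close> is nonnegative. The upper bound depends on \<open>n\<close> alone.\<close>

lemma em_map_deriv:
  assumes "1 \<le> n" "(m - 1 / 2)\<^sup>2 \<le> 1 / 4" "0 < l"
  obtains d where "(em_map 1 n m has_real_derivative d) (at l)" "0 \<le> d" "d \<le> real n / (real n + 1)"
proof -
  define c where "c = (m - 1 / 2)\<^sup>2"
  define N where "N = real n"
  define s where "s = sqrt l"
  define T where "T = tanh (s / 2)"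
  define K where "K = T - s / 2 * (1 - T\<^sup>2)"
  define B where "B = em_rate n l"
  define d where "d = N * K / (4 * s ^ 3) * (1 / B\<^sup>2 + 2 * (N\<^sup>2 * c) / B ^ 3)"
  have s: "0 < s" and N: "1 \<le> N" and T: "0 < T" using assms by (auto simp: s_def N_def T_def)
  have c: "0 \<le> c" "c \<le> 1 / 4" using assms by (auto simp: c_def)
  have sT: "2 * T \<le> s" using tanh_le_self[of "s / 2"] s by (simp add: T_def)
  have B: "1 \<le> B" unfolding B_def using em_rate_bounds assms by blast
  have K0: "0 \<le> K" using self_mult_tanh_deriv_le[of "s / 2"] s by (simp add: K_def T_def)
  \<comment> \<open>Subtracting from \<open>T\<close> turns this into
    \<open>K \<le> T - T * (1 - T\<^sup>2) = T ^ 3\<close>.\<close>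
  have "T * (1 - T\<^sup>2) \<le> s / 2 * (1 - T\<^sup>2)"
    using sT tanh_real_bounds[of "s / 2"]
    by (intro mult_right_mono) (auto simp: T_def abs_square_le_1 abs_le_iff)
  then have K1: "K \<le> T ^ 3" by (simp add: K_def field_simps eval_nat_numeral)
  have "(em_rate n has_real_derivative - N * K / (4 * s ^ 3)) (at l)"
    using em_rate_deriv[OF assms(3), of n] by (simp add: N_def K_def T_def s_def)
  moreover have "((\<lambda>b. 1 / b + N\<^sup>2 * c / b\<^sup>2) has_real_derivative
      - (1 / B\<^sup>2 + 2 * (N\<^sup>2 * c) / B ^ 3)) (at B)"
    using B by (auto intro!: derivative_eq_intros) (simp add: field_simps eval_nat_numeral)
  ultimately have "((\<lambda>l. 1 / em_rate n l + N\<^sup>2 * c / (em_rate n l)\<^sup>2) has_real_derivative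
      - (1 / B\<^sup>2 + 2 * (N\<^sup>2 * c) / B ^ 3) * (- N * K / (4 * s ^ 3))) (at l)"
    unfolding B_def by (intro DERIV_chain2[of "\<lambda>b. 1 / b + N\<^sup>2 * c / b\<^sup>2"])
  also have "- (1 / B\<^sup>2 + 2 * (N\<^sup>2 * c) / B ^ 3) * (- N * K / (4 * s ^ 3)) = d"
    unfolding d_def minus_divide_left[symmetric] mult_minus_left mult_minus_right minus_minus
    by (rule mult.commute)
  finally have "(em_map 1 n m has_real_derivative d) (at l)"
    \<comment> \<open>The closed formula for the map is available only for \<open>l > 0\<close>, an
      open set containing the point.\<close>
    by (rule has_field_derivative_transform_within_open[where S = "{0<..}"])
      (use assms(3) in \<open>auto simp: em_map_eq c_def N_def\<close>)
  moreover have "0 \<le> d" using s N K0 c B by (simp add: d_def)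
  moreover have "d \<le> N / (N + 1)"
  proof -
    \<comment> \<open>Worst case \<open>c = 1 / 4\<close>, attained for sample mean 0 or 1.\<close>
    have "d \<le> N * K / (4 * s ^ 3) * (1 / B\<^sup>2 + 2 * (N\<^sup>2 * (1 / 4)) / B ^ 3)"
      unfolding d_def using s N K0 c B
      by (intro mult_left_mono add_left_mono divide_right_mono) auto
    also have "\<dots> = N * (K * (2 * s + N * T + s * N\<^sup>2)) / (s * (2 * s + N * T) ^ 3)"
    proof -
      define D where "D = 2 * s + N * T"
      have D: "0 < D" using s N T by (simp add: D_def add_pos_pos)
      have BD: "B = D / (2 * s)"
        using s by (simp add: B_def D_def em_rate_def N_def T_def s_def field_simps)
      show ?thesis
        unfolding BD D_def[symmetric] using s D by (simp add: field_simps eval_nat_numeral)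
    qed
    also have "\<dots> \<le> N / (N + 1)"
    proof -
      have "0 < s * (2 * s + N * T) ^ 3" using s N T by (simp add: add_pos_pos)
      then show ?thesis
        using mult_left_mono[OF contraction_bound[OF N s T sT K1], of N] N
        by (simp add: divide_le_eq le_divide_eq mult.commute mult.left_commute)
    qed
    finally show ?thesis .
  qed
  ultimately show ?thesis using that by (simp add: N_def)
qed

text \<open>Mean value theorem: the derivative at the intermediate point, which is again positive,
  lies between 0 and \<open>n / (n + 1)\<close>.\<close>

lemma em_map_contraction:
  assumes "1 \<le> n" "(m - 1 / 2)\<^sup>2 \<le> 1 / 4" "0 < a" "0 < b"
  shows "\<bar>em_map 1 n m a - em_map 1 n m b\<bar> \<le> real n / (real n + 1) * \<bar>a - b\<bar>"
proof -
  have *: "\<bar>em_map 1 n m b - em_map 1 n m a\<bar> \<le> real n / (real n + 1) * \<bar>b - a\<bar>"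
    if ab: "0 < a" "a < b" for a b
  proof -
    have "\<forall>x. \<exists>d. 0 < x \<longrightarrow> (em_map 1 n m has_real_derivative d) (at x) \<and>
       0 \<le> d \<and> d \<le> real n / (real n + 1)"
      using em_map_deriv[OF assms(1,2)] by metis
    then have "\<exists>f'. \<forall>x>0. (em_map 1 n m has_real_derivative f' x) (at x) \<and>
       0 \<le> f' x \<and> f' x \<le> real n / (real n + 1)"
      by metis
    then obtain f' where f': "\<And>x. 0 < x \<Longrightarrow> (em_map 1 n m has_real_derivative f' x) (at x)"
      "\<And>x. 0 < x \<Longrightarrow> 0 \<le> f' x" "\<And>x. 0 < x \<Longrightarrow> f' x \<le> real n / (real n + 1)" by blast
    obtain z where "a < z" "z < b" and z: "em_map 1 n m b - em_map 1 n m a = (b - a) * f' z"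
      using MVT2[OF ab(2), of "em_map 1 n m" f'] f'(1) ab by force
    then have "0 < z" using ab by simp
    then show ?thesis unfolding z using f'(2)[of z] mult_right_mono[OF f'(3)[of z], of "b - a"] ab
      by (simp add: abs_mult mult.commute)
  qed
  show ?thesis
    using *[of a b] *[of b a] assms by (cases a b rule: linorder_cases) (simp_all add: abs_minus_commute)
qed

section \<open>Bounds on the update and existence of a fixed point\<close>

lemma em_map_lower_bound:
  assumes "0 < l"
  shows "1 / (1 + real n / 4) \<le> em_map 1 n m l"
proof -
  have "1 / (1 + real n / 4) \<le> 1 / em_rate n l"
    using em_rate_bounds[OF assms, of n] by (intro divide_left_mono) auto
  then show ?thesis by (simp add: em_map_eq[OF assms] add_increasing2)
qed

lemma em_map_pos: "0 < l \<Longrightarrow> 0 < em_map 1 n m l"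
  by (rule less_le_trans[OF _ em_map_lower_bound]) (simp_all add: add_pos_nonneg)

lemma em_map_upper_bound:
  assumes "0 < l"
  shows "em_map 1 n m l \<le> 1 + (real n)\<^sup>2 * (m - 1 / 2)\<^sup>2"
proof -
  have B: "1 \<le> em_rate n l" using em_rate_bounds[OF assms] by blast
  have "1 / em_rate n l \<le> 1" using B by simp
  moreover have "(real n)\<^sup>2 * (m - 1 / 2)\<^sup>2 / (em_rate n l)\<^sup>2 \<le> (real n)\<^sup>2 * (m - 1 / 2)\<^sup>2 / 1"
    using B by (intro divide_left_mono) auto
  ultimately show ?thesis by (simp add: em_map_eq[OF assms])
qed

text \<open>The open half-line is not complete, so a positive lower bound on the values is what
  keeps the fixed point off 0. The function \<open>x - em_map 1 n m x\<close> is at most 0 at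
  \<open>lo\<close> and at least 0 at \<open>hi\<close>; the intermediate value theorem gives a zero
  between them.\<close>

lemma em_map_fixed_point:
  assumes "1 \<le> n" "(m - 1 / 2)\<^sup>2 \<le> 1 / 4"
  obtains a where "0 < a" "em_map 1 n m a = a"
proof -
  define lo where "lo = 1 / (1 + real n / 4)"
  define hi where "hi = 1 + (real n)\<^sup>2 * (m - 1 / 2)\<^sup>2"
  have lo: "0 < lo" "lo \<le> 1" by (simp_all add: lo_def add_pos_nonneg)
  have hi: "1 \<le> hi" by (simp add: hi_def)
  have "isCont (em_map 1 n m) x" if "0 < x" for x
    using em_map_deriv[OF assms that] DERIV_isCont by metis
  then have "\<exists>x\<ge>lo. x \<le> hi \<and> x - em_map 1 n m x = 0"
    using lo hi em_map_lower_bound[of lo n m] em_map_upper_bound[of hi n m]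
    by (intro IVT) (auto simp: lo_def[symmetric] hi_def[symmetric] intro!: continuous_intros)
  then obtain x where "lo \<le> x" "x - em_map 1 n m x = 0" by blast
  then show ?thesis using that[of x] lo by simp
qed

section \<open>Global stability and geometric convergence\<close>

lemma contraction_globally_asymptotically_stable:
  assumes "a \<in> D" "f a = a" "0 < r" "r < 1"
    and maps: "\<And>x. x \<in> D \<Longrightarrow> f x \<in> D"
    and contr: "\<And>x. x \<in> D \<Longrightarrow> \<bar>f x - a\<bar> \<le> r * \<bar>x - a\<bar>"
  shows "globally_asymptotically_stable D f a"
proof -
  have iter: "(f ^^ t) x \<in> D \<and> \<bar>(f ^^ t) x - a\<bar> \<le> r ^ t * \<bar>x - a\<bar>" if "x \<in> D" for t x
  proof (induction t)
    case 0
    show ?case using that by simp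
  next
    case (Suc t)
    have "\<bar>f ((f ^^ t) x) - a\<bar> \<le> r * \<bar>(f ^^ t) x - a\<bar>" using Suc contr by blast
    also have "\<dots> \<le> r * (r ^ t * \<bar>x - a\<bar>)" using Suc assms by (intro mult_left_mono) auto
    finally show ?case using Suc maps by (simp add: mult.assoc)
  qed
  have lim: "(\<lambda>t. (f ^^ t) x) \<longlonglongrightarrow> a" if "x \<in> D" for x
  proof (rule LIM_zero_cancel, rule tendsto_0_le[where K = 1])
    show "(\<lambda>t. r ^ t * \<bar>x - a\<bar>) \<longlonglongrightarrow> 0"
      using assms by (intro tendsto_mult_left_zero LIMSEQ_realpow_zero) auto
  qed (use iter[OF that] assms(3) in auto)
  \<comment> \<open>The stability condition concerns \<open>f\<close> applied to the state at time
    \<open>t\<close>, hence the iterate \<open>Suc t\<close>.\<close>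
  have stable: "\<bar>f ((f ^^ t) x) - a\<bar> \<le> \<bar>x - a\<bar>" if "x \<in> D" for t x
  proof -
    have "\<bar>(f ^^ Suc t) x - a\<bar> \<le> r ^ Suc t * \<bar>x - a\<bar>" using iter[OF that] by blast
    also have "\<dots> \<le> \<bar>x - a\<bar>" using assms by (intro mult_left_le_one_le power_le_one) auto
    finally show ?thesis by simp
  qed
  \<comment> \<open>Stability holds with \<open>\<delta> = \<epsilon>\<close>; for local attraction
    any radius works, such as 1.\<close>
  show ?thesis
    unfolding globally_asymptotically_stable_def asymptotically_stable_def
    using assms(1,2) lim stable by (meson le_less_trans zero_less_one)
qed

lemma em_map_globally_asymptotically_stable:
  assumes "1 \<le> n" "(m - 1 / 2)\<^sup>2 \<le> 1 / 4" "0 < a" "em_map 1 n m a = a"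
  shows "globally_asymptotically_stable {0<..} (em_map 1 n m) a"
  using assms em_map_contraction[OF assms(1,2) _ assms(3)] em_map_pos
  by (intro contraction_globally_asymptotically_stable[where r = "real n / (real n + 1)"]) auto

text \<open>The signs of \<open>z t\<close> are free, so \<open>z\<close> itself need not be an
  orbit; its squares are an orbit of \<open>em_map\<close>, and they stay in the domain because
  \<open>z 0 \<noteq> 0\<close> and the map preserves positivity.\<close>

lemma em_trajectory_contraction:
  assumes "1 \<le> n" "(m - 1 / 2)\<^sup>2 \<le> 1 / 4" "0 < a" "em_map 1 n m a = a"
    and "z 0 \<noteq> 0" "\<And>t. (z (Suc t))\<^sup>2 = em_update 1 n m (z t)"
  shows "\<bar>(z t)\<^sup>2 - a\<bar> \<le> (real n / (real n + 1)) ^ t * \<bar>(z 0)\<^sup>2 - a\<bar>"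
proof -
  let ?r = "real n / (real n + 1)"
  have step: "(z (Suc t))\<^sup>2 = em_map 1 n m ((z t)\<^sup>2)" for t
    using assms(6) by (simp add: em_update_eq_em_map)
  have pos: "0 < (z t)\<^sup>2" for t
    by (induction t) (use assms(5) step em_map_pos in auto)
  show ?thesis
  proof (induction t)
    case 0
    show ?case by simp
  next
    case (Suc t)
    have "\<bar>(z (Suc t))\<^sup>2 - a\<bar> \<le> ?r * \<bar>(z t)\<^sup>2 - a\<bar>"
      using em_map_contraction[OF assms(1,2) pos assms(3), of t] assms(4) by (simp only: step)
    also have "\<dots> \<le> ?r * (?r ^ t * \<bar>(z 0)\<^sup>2 - a\<bar>)"
      using Suc by (intro mult_left_mono) auto
    finally show ?case by (simp only: power_Suc mult.assoc)
  qed
qed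

text \<open>Source of the hypothesis on \<open>m\<close> above: a mean of values in the unit
  interval is within \<open>1 / 2\<close> of its midpoint.\<close>

lemma col_mean_centered_sq_le:
  assumes "1 \<le> n" "\<And>i. i \<in> {1..n} \<Longrightarrow> 0 \<le> y i j \<and> y i j \<le> 1"
  shows "(col_mean n y j - 1 / 2)\<^sup>2 \<le> 1 / 4"
proof -
  let ?S = "\<Sum>i = 1..n. y i j"
  have "0 \<le> ?S" using assms by (intro sum_nonneg) auto
  moreover have "?S \<le> real n" using sum_bounded_above[of "{1..n}" "\<lambda>i. y i j" 1] assms by simp
  ultimately have "\<bar>col_mean n y j - 1 / 2\<bar> \<le> 1 / 2"
    using assms(1) by (simp add: col_mean_def abs_le_iff field_simps)
  then have "\<bar>col_mean n y j - 1 / 2\<bar>\<^sup>2 \<le> (1 / 2)\<^sup>2" by (intro power_mono) auto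
  then show ?thesis by (simp add: power_divide)
qed

theorem theorem4p2:
  fixes n p :: nat and y :: "nat \<Rightarrow> nat \<Rightarrow> real"
  assumes "n \<ge> 2" and "p \<ge> 1"
    and "\<forall>i\<in>{1..n}. \<forall>j\<in>{1..p}. y i j \<in> {0, 1}"
  shows "\<exists>ls :: nat \<Rightarrow> real.
      (\<forall>j\<in>{1..p}. globally_asymptotically_stable {0<..} (em_map 1 n (col_mean n y j)) (ls j)) \<and>
      (\<exists>\<rho>. 0 < \<rho> \<and> \<rho> < 1 \<and>
        (\<forall>\<zeta>. em_trajectory 1 n p y \<zeta> \<longrightarrow>
          (\<forall>t. \<forall>j\<in>{1..p}. \<bar>(\<zeta> t j)\<^sup>2 - ls j\<bar> \<le> \<rho> ^ t * \<bar>(\<zeta> 0 j)\<^sup>2 - ls j\<bar>)))"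
proof -
  have n: "1 \<le> n" using assms(1) by simp
  have m: "(col_mean n y j - 1 / 2)\<^sup>2 \<le> 1 / 4" if "j \<in> {1..p}" for j
    using assms(3) that by (intro col_mean_centered_sq_le[OF n]) force
  then have "\<forall>j\<in>{1..p}. \<exists>a>0. em_map 1 n (col_mean n y j) a = a"
    using em_map_fixed_point[OF n] by metis
  then obtain ls where ls: "\<And>j. j \<in> {1..p} \<Longrightarrow> 0 < ls j"
    "\<And>j. j \<in> {1..p} \<Longrightarrow> em_map 1 n (col_mean n y j) (ls j) = ls j"
    by metis
  \<comment> \<open>The witness for \<open>\<rho>\<close> is \<open>n / (n + 1)\<close>, the same
    for all coordinates, times and initializations.\<close>
  have "\<bar>(\<zeta> t j)\<^sup>2 - ls j\<bar> \<le> (real n / (real n + 1)) ^ t * \<bar>(\<zeta> 0 j)\<^sup>2 - ls j\<bar>"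
    if "em_trajectory 1 n p y \<zeta>" "j \<in> {1..p}" for \<zeta> t j
    using that em_trajectory_contraction[OF n m ls, of j "\<lambda>t. \<zeta> t j" t]
    by (simp add: em_trajectory_def)
  moreover have "0 < real n / (real n + 1)" "real n / (real n + 1) < 1" using n by simp_all
  ultimately show ?thesis
    using em_map_globally_asymptotically_stable[OF n m ls] by blast
qed

end
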